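(* Let $n\geq 10$ be an even integer, let $c\geq 0$ be a real number, and let $m$ be an integer with $m>4n\log n+cn$. Let $E^m(n)$ denote the expected number of correct guesses using the best no feedback guessing strategy for a deck of $n$ cards after $m$ top to random shuffles. Then $$E^m(n)-1\leq e^{-c}.$$
   Context: The deck consists of $n$ cards labeled $1,\dots,n$, initially ordered with card $1$ on top (position $1$) through card $n$ at the bottom (position $n$). One top to random shuffle removes the top card and reinserts it into the deck at a position chosen uniformly from $\{1,\dots,n\}$ (each with probability $1/n$); successive shuffles are independent. After $m$ shuffles the deck is placed face down and a guesser names a card for each position, receiving no information during the process. A no feedback guessing strategy is thus an assignment $g:\{1,\dots,n\}\to\{1,\dots,n\}$ of a guessed card $g(k)$ to each position $k$ (repeated guesses are allowed), and the number of correct guesses is the number of positions $k$ at which the card is $g(k)$. A best no feedback guessing strategy is one maximizing the expected number of correct guesses. $\log$ is the natural logarithm. *)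

theory Defs
  imports "HOL-Probability.Probability"
begin

text \<open>A deck is the list of its cards from top to bottom. Positions are numbered from 1, so the
  card at position \<open>k\<close> is \<open>d ! (k - 1)\<close>.\<close>

definition card_at :: "nat list \<Rightarrow> nat \<Rightarrow> nat" where
  "card_at d k = d ! (k - 1)"

definition move_top_to :: "nat \<Rightarrow> nat list \<Rightarrow> nat list" where
  "move_top_to j d = take (j - 1) (tl d) @ [hd d] @ drop (j - 1) (tl d)"

definition top_to_random :: "nat list \<Rightarrow> nat list pmf" where
  "top_to_random d = map_pmf (\<lambda>j. move_top_to j d) (pmf_of_set {1..length d})"

primrec deck_after :: "nat \<Rightarrow> nat \<Rightarrow> nat list pmf" where
  "deck_after n 0 = return_pmf [1..<Suc n]"
| "deck_after n (Suc m) = bind_pmf (deck_after n m) top_to_random"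

definition guessing_strategies :: "nat \<Rightarrow> (nat \<Rightarrow> nat) set" where
  "guessing_strategies n = {1..n} \<rightarrow>\<^sub>E {1..n}"

definition correct_guesses :: "nat \<Rightarrow> (nat \<Rightarrow> nat) \<Rightarrow> nat list \<Rightarrow> nat" where
  "correct_guesses n g d = card {k \<in> {1..n}. card_at d k = g k}"

definition expected_correct :: "nat \<Rightarrow> nat \<Rightarrow> (nat \<Rightarrow> nat) \<Rightarrow> real" where
  "expected_correct n m g =
     measure_pmf.expectation (deck_after n m) (\<lambda>d. real (correct_guesses n g d))"

text \<open>The set of strategies is finite and nonempty, so the maximum is attained by a best strategy.\<close>

definition best_expected_correct :: "nat \<Rightarrow> nat \<Rightarrow> real" where
  "best_expected_correct n m = Max (expected_correct n m ` guessing_strategies n)"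

end

theory Submission
  imports Defs
begin

text \<open>Follow one card. Its position is a doubly stochastic Markov chain, so we may fix the final
  position \<open>k\<close> and run the recursion backwards in the starting position \<open>i\<close>. Split the probability of
  ending at \<open>k\<close> according to whether the card has been reinserted from the top in the meantime. At
  \<open>i = 1\<close> the first part equals \<open>1/n\<close>, by double stochasticity, and elsewhere it is averaged, so it
  never exceeds \<open>1/n\<close>. The second part, summed over \<open>i\<close>, shrinks by the factor \<open>1 - 1/n\<close> in each
  step. Hence every card is at position \<open>k\<close> with probability at most \<open>1/n + (1 - 1/n)^m\<close>, and
  \<open>n (1 - 1/n)^m \<le> n exp (- m/n)\<close> is far below \<open>exp (- c)\<close>.\<close>

section \<open>Position of a single card and its backward operators\<close>

definition deck_prob :: "nat \<Rightarrow> nat \<Rightarrow> nat \<Rightarrow> nat \<Rightarrow> real" where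
  "deck_prob n m i k = measure_pmf.expectation (deck_after n m) (\<lambda>d. of_bool (card_at d k = i))"

text \<open>This averages \<open>f\<close> over the next position of a card at \<open>p\<close> with
  \<open>2 \<le> p \<le> n\<close>: it stays when the top card goes in above it, in
  \<open>p - 1\<close> cases, and rises by one otherwise. The value 0 at the top discards the card
  that is about to be reinserted.\<close>

definition killed_step :: "nat \<Rightarrow> (nat \<Rightarrow> real) \<Rightarrow> nat \<Rightarrow> real" where
  "killed_step n f p =
     (if p = 1 then 0 else (real (p - 1) * f p + real (n + 1 - p) * f (p - 1)) / real n)"

text \<open>The full transition operator of one card: the uniform reinsertion from the top restores
  what \<open>killed_step\<close> discards.\<close>

definition card_step :: "nat \<Rightarrow> (nat \<Rightarrow> real) \<Rightarrow> nat \<Rightarrow> real" where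
  "card_step n f p = killed_step n f p + of_bool (p = 1) * (\<Sum>q=1..n. f q) / real n"

section \<open>One shuffle and the forward recursion\<close>

lemma length_move_top_to: "d \<noteq> [] \<Longrightarrow> length (move_top_to j d) = length d"
  by (cases d) (auto simp: move_top_to_def)

lemma card_at_move_top_to:
  assumes "1 \<le> j" "j \<le> length d" "1 \<le> k" "k \<le> length d"
  shows "card_at (move_top_to j d) k = (if k < j then card_at d (k + 1) else
           if k = j then card_at d 1 else card_at d k)"
  using assms
  by (cases d) (auto simp: card_at_def move_top_to_def nth_append nth_Cons split: nat.splits
    intro!: arg_cong[where f = "nth _"])

lemma set_deck_after_length:
  assumes "n > 0" "d \<in> set_pmf (deck_after n m)"
  shows "length d = n"
  using assms(2)
proof (induction m arbitrary: d)
  case (Suc m)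
  then obtain d' where d': "d' \<in> set_pmf (deck_after n m)" "d \<in> set_pmf (top_to_random d')"
    by auto
  then have "length d' = n" using Suc.IH by blast
  then show ?case using d'(2) assms(1) length_move_top_to[of d']
    by (force simp: top_to_random_def)
qed simp

lemma finite_set_deck_after:
  assumes "n > 0"
  shows "finite (set_pmf (deck_after n m))"
proof (induction m)
  case (Suc m)
  have "finite (set_pmf (top_to_random d))" if "d \<in> set_pmf (deck_after n m)" for d
    using set_deck_after_length[OF assms that] assms by (simp add: top_to_random_def)
  then show ?case using Suc by simp
qed simp

lemma sum_three_way:
  fixes a b c :: real
  assumes "1 \<le> k" "k \<le> n"
  shows "(\<Sum>j=1..n. if k < j then a else if k = j then b else c)
           = real (n - k) * a + b + real (k - 1) * c"
proof -
  let ?f = "\<lambda>j. if k < j then a else if k = j then b else c"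
  have "{1..n} = {1..<k} \<union> ({k} \<union> {k<..n})" using assms by auto
  then have "(\<Sum>j=1..n. ?f j) = (\<Sum>j\<in>{1..<k} \<union> ({k} \<union> {k<..n}). ?f j)" by simp
  also have "\<dots> = (\<Sum>j\<in>{1..<k}. ?f j) + ((\<Sum>j\<in>{k}. ?f j) + (\<Sum>j\<in>{k<..n}. ?f j))"
    by (subst sum.union_disjoint, force, force, force, subst sum.union_disjoint) auto
  also have "(\<Sum>j\<in>{1..<k}. ?f j) = (\<Sum>j\<in>{1..<k}. c)"
    by (intro sum.cong) auto
  also have "(\<Sum>j\<in>{k<..n}. ?f j) = (\<Sum>j\<in>{k<..n}. a)"
    by (intro sum.cong) auto
  finally show ?thesis by simp
qed

text \<open>Condition on the insertion position \<open>j\<close>: position \<open>k\<close> keeps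
  its card if \<open>j < k\<close>, gets the old top card if \<open>j = k\<close>, and gets the card
  from below if \<open>j > k\<close>. At \<open>k = n\<close> the entry \<open>k + 1\<close> lies
  beyond the deck, but its coefficient is 0.\<close>

lemma deck_prob_Suc:
  assumes "1 \<le> k" "k \<le> n"
  shows "deck_prob n (Suc m) i k = (real (k - 1) * deck_prob n m i k + deck_prob n m i 1
            + real (n - k) * deck_prob n m i (k + 1)) / real n"
proof -
  have n: "n > 0" using assms by simp
  have int: "integrable (measure_pmf (deck_after n m)) (\<lambda>d. of_bool (card_at d q = i) :: real)" for q
    by (rule measure_pmf.integrable_const_bound[where B = 1]) auto
  have "deck_prob n (Suc m) i k = measure_pmf.expectation (deck_after n m)
      (\<lambda>d. measure_pmf.expectation (top_to_random d) (\<lambda>d. of_bool (card_at d k = i)))"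
    using n set_deck_after_length[OF n] finite_set_deck_after[OF n]
    unfolding deck_prob_def deck_after.simps
    by (subst pmf_expectation_bind[of "set_pmf (deck_after n m)"])
      (auto simp: top_to_random_def integral_measure_pmf[OF finite_set_deck_after[OF n]])
  also have "\<dots> = measure_pmf.expectation (deck_after n m)
      (\<lambda>d. (real (k - 1) * of_bool (card_at d k = i) + of_bool (card_at d 1 = i)
            + real (n - k) * of_bool (card_at d (k + 1) = i)) / real n)"
  proof (intro integral_cong_AE, simp, simp, rule AE_pmfI)
    fix d assume "d \<in> set_pmf (deck_after n m)"
    then have len: "length d = n" using set_deck_after_length n by blast
    have "measure_pmf.expectation (top_to_random d) (\<lambda>d. of_bool (card_at d k = i))
        = (\<Sum>j=1..n. of_bool (card_at (move_top_to j d) k = i)) / real n"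
      using n by (simp add: top_to_random_def len integral_pmf_of_set)
    also have "(\<Sum>j=1..n. of_bool (card_at (move_top_to j d) k = i))
        = (\<Sum>j=1..n. if k < j then of_bool (card_at d (k + 1) = i) else
           if k = j then of_bool (card_at d 1 = i) else of_bool (card_at d k = i) :: real)"
      using assms len by (intro sum.cong) (auto simp: card_at_move_top_to)
    finally show "measure_pmf.expectation (top_to_random d) (\<lambda>d. of_bool (card_at d k = i))
        = (real (k - 1) * of_bool (card_at d k = i) + of_bool (card_at d 1 = i)
            + real (n - k) * of_bool (card_at d (k + 1) = i)) / real n"
      by (simp only: sum_three_way[OF assms] add_ac)
  qed
  also have "\<dots> = (real (k - 1) * deck_prob n m i k + deck_prob n m i 1
            + real (n - k) * deck_prob n m i (k + 1)) / real n"
    unfolding deck_prob_def by (simp add: int)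
  finally show ?thesis .
qed

section \<open>Duality of forward and backward steps\<close>

lemma sum_shift_down:
  fixes h :: "nat \<Rightarrow> real"
  assumes "n > 0" "h n = 0"
  shows "(\<Sum>p=1..n. h p) = (\<Sum>p=1..n. if p = 1 then 0 else h (p - 1))"
proof -
  have "(\<Sum>p=1..n. if p = 1 then 0 else h (p - 1)) = (\<Sum>p=Suc 1..n. if p = 1 then 0 else h (p - 1))"
    using assms by (subst sum.atLeast_Suc_atMost) auto
  also have "\<dots> = (\<Sum>p=Suc 1..n. h (p - 1))"
    by (intro sum.cong) auto
  also have "\<dots> = (\<Sum>p=1..n - 1. h p)"
    using assms by (intro sum.reindex_bij_witness[of _ Suc "\<lambda>p. p - 1"]) auto
  also have "\<dots> = (\<Sum>p=1..n. h p)"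
    using assms by (cases n) auto
  finally show ?thesis by simp
qed

text \<open>Shifting the index in the \<open>f (p - 1)\<close> terms transposes the operator; the
  boundary term vanishes because \<open>n - p = 0\<close> at \<open>p = n\<close>. The result is the
  forward recursion without the contribution of the top card.\<close>

lemma sum_killed_step_adjoint:
  assumes "n > 0"
  shows "(\<Sum>p=1..n. x p * killed_step n f p)
           = (\<Sum>p=1..n. (real (p - 1) * x p + real (n - p) * x (p + 1)) * f p) / real n"
proof -
  have "(\<Sum>p=1..n. real (n - p) * x (p + 1) * f p)
      = (\<Sum>p=1..n. if p = 1 then 0 else real (n - (p - 1)) * x (p - 1 + 1) * f (p - 1))"
    using assms by (intro sum_shift_down) auto
  moreover have "(\<Sum>p=1..n. x p * killed_step n f p)
      = (\<Sum>p=1..n. real (p - 1) * x p * f p / real n +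
          (if p = 1 then 0 else real (n - (p - 1)) * x (p - 1 + 1) * f (p - 1)) / real n)"
    using assms by (intro sum.cong) (auto simp: killed_step_def field_simps Suc_diff_le)
  ultimately show ?thesis
    by (simp only: sum.distrib sum_divide_distrib[symmetric] ring_distribs add_divide_distrib)
qed

lemma deck_prob_Suc_dual:
  assumes "n > 0"
  shows "(\<Sum>k=1..n. deck_prob n (Suc m) i k * f k) = (\<Sum>k=1..n. deck_prob n m i k * card_step n f k)"
proof -
  let ?x = "deck_prob n m i"
  have "(\<Sum>k=1..n. deck_prob n (Suc m) i k * f k) = (\<Sum>k=1..n.
      ((real (k - 1) * ?x k + real (n - k) * ?x (k + 1)) * f k) / n + ?x 1 / n * f k)"
    by (intro sum.cong) (auto simp: deck_prob_Suc field_simps)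
  also have "\<dots> = (\<Sum>k=1..n. ?x k * killed_step n f k) + ?x 1 / n * (\<Sum>k=1..n. f k)"
    by (simp only: sum_killed_step_adjoint[OF assms] sum.distrib sum_divide_distrib sum_distrib_left)
  \<comment> \<open>The reinsertion term becomes a sum supported at \<open>k = 1\<close>, which
    completes \<open>killed_step\<close> to \<open>card_step\<close>.\<close>
  also have "?x 1 / n * (\<Sum>k=1..n. f k)
      = (\<Sum>k=1..n. if k = 1 then ?x 1 * (\<Sum>q=1..n. f q) / n else 0)"
    using assms by (simp add: sum.delta)
  finally show ?thesis
    by (simp only: sum.distrib[symmetric]) (auto simp: card_step_def ring_distribs intro!: sum.cong)
qed

lemma deck_prob_0: "1 \<le> k \<Longrightarrow> k \<le> n \<Longrightarrow> deck_prob n 0 i k = of_bool (k = i)"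
  by (simp add: deck_prob_def card_at_def del: upt_Suc)

lemma deck_prob_dual:
  assumes "1 \<le> i" "i \<le> n"
  shows "(\<Sum>k=1..n. deck_prob n m i k * f k) = (card_step n ^^ m) f i"
proof (induction m arbitrary: f)
  case 0
  have "(\<Sum>k=1..n. deck_prob n 0 i k * f k) = (\<Sum>k=1..n. if k = i then f k else 0)"
    by (intro sum.cong) (auto simp: deck_prob_0)
  then show ?case using assms by (simp add: sum.delta)
next
  case (Suc m)
  \<comment> \<open>The last shuffle is moved onto \<open>f\<close>, so the induction hypothesis is
    needed at \<open>card_step n f\<close>.\<close>
  have "(\<Sum>k=1..n. deck_prob n (Suc m) i k * f k) = (card_step n ^^ m) (card_step n f) i"
    using assms by (simp only: deck_prob_Suc_dual Suc.IH)
  then show ?case by (simp add: funpow_swap1)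
qed

section \<open>Conserved and decaying totals, and the pointwise bound\<close>

lemma total_killed_step:
  assumes "n > 0"
  shows "(\<Sum>p=1..n. killed_step n f p) = (1 - 1 / real n) * (\<Sum>p=1..n. f p)"
proof -
  \<comment> \<open>With constant weight 1 the adjoint has coefficients
    \<open>(p - 1) + (n - p) = n - 1\<close>.\<close>
  have "(\<Sum>p=1..n. killed_step n f p) = (\<Sum>p=1..n. (real n - 1) * f p) / real n"
    using sum_killed_step_adjoint[OF assms, of "\<lambda>_. 1" f]
    by (auto intro!: sum.cong arg_cong[where f = "\<lambda>s. s / _"] simp: of_nat_diff)
  also have "\<dots> = (real n - 1) * (\<Sum>p=1..n. f p) / real n"
    by (simp only: sum_distrib_left)
  finally show ?thesis using assms by (simp add: field_simps)
qed

text \<open>Double stochasticity: reinsertion returns exactly the fraction \<open>1 / n\<close> of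
  the total that killing removes.\<close>

lemma total_card_step:
  assumes "n > 0"
  shows "(\<Sum>p=1..n. card_step n f p) = (\<Sum>p=1..n. f p)"
proof -
  have "(\<Sum>p=1..n. of_bool (p = 1) * (\<Sum>q=1..n. f q) / real n) = (\<Sum>q=1..n. f q) / real n"
    using assms by (simp add: of_bool_def if_distrib[of "\<lambda>x. x * _ / _"] sum.delta cong: if_cong)
  then show ?thesis using assms
    by (simp only: card_step_def sum.distrib total_killed_step) (simp add: field_simps)
qed

lemma total_card_step_funpow:
  "n > 0 \<Longrightarrow> (\<Sum>p=1..n. (card_step n ^^ m) f p) = (\<Sum>p=1..n. f p)"
  by (induction m) (simp_all only: funpow.simps o_apply total_card_step id_apply)

lemma total_killed_step_funpow:
  "n > 0 \<Longrightarrow> (\<Sum>p=1..n. (killed_step n ^^ m) f p) = (1 - 1 / real n) ^ m * (\<Sum>p=1..n. f p)"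
  by (induction m) (simp_all only: funpow.simps o_apply total_killed_step power.simps mult_ac id_apply mult_1)

lemma killed_step_funpow_nonneg: "(\<And>p. 0 \<le> f p) \<Longrightarrow> 0 \<le> (killed_step n ^^ m) f p"
  by (induction m arbitrary: p) (auto simp: killed_step_def)

lemma card_step_funpow_le:
  assumes f: "(\<Sum>p=1..n. f p) = 1" "\<And>p. 0 \<le> f p" and p: "1 \<le> p" "p \<le> n"
  shows "(card_step n ^^ m) f p \<le> 1 / n + (killed_step n ^^ m) f p"
  using p
proof (induction m arbitrary: p)
  case (Suc m)
  let ?y = "(card_step n ^^ m) f" and ?r = "(killed_step n ^^ m) f"
  have n: "n > 0" using Suc.prems by simp
  show ?case
  proof (cases "p = 1")
    case True
    then have "(card_step n ^^ Suc m) f p = (\<Sum>q=1..n. ?y q) / real n"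
      by (simp add: card_step_def killed_step_def)
    also have "\<dots> = 1 / real n"
      by (simp only: total_card_step_funpow[OF n] f(1))
    finally show ?thesis
      using True by (simp add: killed_step_def)
  next
    case False
    have "real (p - 1) * ?y p + real (n + 1 - p) * ?y (p - 1)
        \<le> real (p - 1) * (1 / n + ?r p) + real (n + 1 - p) * (1 / n + ?r (p - 1))"
      using Suc False by (intro add_mono mult_left_mono) auto
    also have "\<dots> = (real (p - 1) + real (n + 1 - p)) * (1 / n)
        + (real (p - 1) * ?r p + real (n + 1 - p) * ?r (p - 1))"
      by (simp only: ring_distribs add_ac)
    \<comment> \<open>Away from the top a step is a true average, so the constant
      \<open>1 / n\<close> reproduces itself.\<close>
    also have "real (p - 1) + real (n + 1 - p) = real n"
      using Suc.prems by (simp add: of_nat_diff)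
    finally show ?thesis
      using n False by (simp add: card_step_def killed_step_def divide_simps)
  qed
qed (use f in simp)

text \<open>Duality is applied to the indicator of \<open>k\<close>. The killed part at
  \<open>i\<close> is one term of a nonnegative sum over all starting positions, and that sum decays
  geometrically.\<close>

lemma deck_prob_le:
  assumes i: "1 \<le> i" "i \<le> n" and k: "1 \<le> k" "k \<le> n"
  shows "deck_prob n m i k \<le> 1 / n + (1 - 1 / real n) ^ m"
proof -
  let ?f = "\<lambda>p. of_bool (p = k) :: real"
  have n: "n > 0" using i by simp
  have f1: "(\<Sum>p=1..n. ?f p) = 1" using k by (simp add: of_bool_def sum.delta)
  have "deck_prob n m i k = (\<Sum>p=1..n. deck_prob n m i p * ?f p)"
    using k by (simp add: of_bool_def if_distrib[of "\<lambda>x. _ * x"] sum.delta cong: if_cong)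
  also have "\<dots> \<le> 1 / n + (killed_step n ^^ m) ?f i"
    using deck_prob_dual[OF i, of m ?f] card_step_funpow_le[OF f1 _ i, of m] by simp
  also have "(killed_step n ^^ m) ?f i \<le> (\<Sum>p=1..n. (killed_step n ^^ m) ?f p)"
    using i by (intro member_le_sum killed_step_funpow_nonneg) auto
  also have "\<dots> = (1 - 1 / real n) ^ m"
    using total_killed_step_funpow[OF n, of m ?f] f1 by simp
  finally show ?thesis by simp
qed

section \<open>From single positions to the expected score\<close>

lemma expected_correct_eq: "expected_correct n m g = (\<Sum>k=1..n. deck_prob n m (g k) k)"
proof -
  have "integrable (measure_pmf (deck_after n m)) (\<lambda>d. of_bool (card_at d k = g k) :: real)" for k
    by (rule measure_pmf.integrable_const_bound[where B = 1]) auto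
  moreover have "real (correct_guesses n g d) = (\<Sum>k=1..n. of_bool (card_at d k = g k))" for d
    by (simp add: correct_guesses_def sum.inter_filter[symmetric] of_bool_def)
  ultimately show ?thesis
    by (simp only: expected_correct_def deck_prob_def Bochner_Integration.integral_sum)
qed

text \<open>The bound on \<open>deck_prob\<close> is uniform in the guessed card, so summing it over
  the \<open>n\<close> positions bounds every strategy alike.\<close>

lemma best_expected_correct_le:
  assumes "n > 0"
  shows "best_expected_correct n m \<le> 1 + real n * (1 - 1 / real n) ^ m"
proof -
  have "expected_correct n m g \<le> 1 + real n * (1 - 1 / real n) ^ m"
    if "g \<in> guessing_strategies n" for g
  proof -
    have "expected_correct n m g \<le> (\<Sum>k=1..n. 1 / n + (1 - 1 / real n) ^ m)"
      unfolding expected_correct_eq using that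
      by (intro sum_mono deck_prob_le) (auto simp: guessing_strategies_def PiE_iff)
    also have "\<dots> = 1 + real n * (1 - 1 / real n) ^ m"
      using assms by (simp add: ring_distribs)
    finally show ?thesis .
  qed
  moreover have "finite (guessing_strategies n)" "guessing_strategies n \<noteq> {}"
    using assms by (auto simp: guessing_strategies_def PiE_eq_empty_iff intro: finite_PiE)
  ultimately show ?thesis
    unfolding best_expected_correct_def by (subst Max_le_iff) auto
qed

theorem theorem4p1:
  fixes n m :: nat and c :: real
  assumes "n \<ge> 10" and "even n" and "c \<ge> 0"
    and "real m > 4 * real n * ln (real n) + c * real n"
  shows "best_expected_correct n m - 1 \<le> exp (- c)"
proof -
  have n: "real n > 0" "ln (real n) \<ge> 0" using assms(1) by auto
  have "(1 - 1 / real n) ^ m \<le> exp (- (1 / real n)) ^ m"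
    using n assms(1) exp_ge_add_one_self[of "- (1 / real n)"] by (intro power_mono) auto
  also have "\<dots> = exp (- (real m / real n))"
    by (simp add: exp_of_nat_mult[symmetric])
  \<comment> \<open>The term \<open>ln n\<close> in the exponent supplies a factor
    \<open>1 / n\<close>, which cancels the number of positions.\<close>
  also have "\<dots> \<le> exp (- ln (real n) - c)"
  proof -
    have "(ln (real n) + c) * real n \<le> 4 * real n * ln (real n) + c * real n"
      using n by (simp add: algebra_simps)
    then have "ln (real n) + c \<le> real m / real n"
      using assms(4) n by (simp add: pos_le_divide_eq)
    then show ?thesis by simp
  qed
  also have "\<dots> = exp (- c) / real n"
    using n by (simp add: exp_diff exp_minus field_simps)
  finally have "real n * (1 - 1 / real n) ^ m \<le> exp (- c)"
    using n by (simp add: field_simps)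
  then show ?thesis
    using best_expected_correct_le[of n m] n by simp
qed

end
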